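(* Let $\mathcal{A}$ be any scattering algorithm for mobile robots (not necessarily canonical). Then the expected number of random bits needed by $\mathcal{A}$ to scatter $n$ robots is at least $n\log_2 n$.
   Context: Mobile robot model: robots are points in the Euclidean plane; they are anonymous (identical, all running the same algorithm), oblivious (no memory between cycles) and disoriented (each has its own local coordinate system; robots at the same point have identical local coordinate systems). Execution is fully synchronous: in each round every robot simultaneously Looks (snapshot of all positions), Computes a destination (possibly using random choices) and Moves toward it. A configuration is the multiset of robot positions; it is scattered when no two robots share a position. A scattering algorithm is one that, from any initial configuration, eventually reaches a scattered configuration. Random bits: a robot choosing uniformly at random among $k$ possibilities uses $\log_2 k$ random bits; random bits used by robots that are alone at their position are not counted; an execution uses only finitely many random bits. *)

theory Defs
  imports "HOL-Probability.Probability"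
begin

type_synonym point = "real^2"

text \<open>Robots are the numbers below \<open>n\<close>; values of a configuration at other indices are
  irrelevant and never change. The indices are invisible to the algorithm.\<close>

type_synonym config = "nat \<Rightarrow> point"

definition scattered :: "nat \<Rightarrow> config \<Rightarrow> bool" where
  "scattered n C \<longleftrightarrow> inj_on C {..<n}"

definition alone :: "nat \<Rightarrow> config \<Rightarrow> nat \<Rightarrow> bool" where
  "alone n C i \<longleftrightarrow> (\<forall>j<n. C j = C i \<longrightarrow> j = i)"


text \<open>A randomized computation is a decision tree in which \<open>Choose m f\<close> selects an element \<open>j\<close>
  uniformly among the \<open>m + 1\<close> possibilities \<open>0, \<dots>, m\<close> and continues with \<open>f j\<close>. Every branch of such
  a tree is finite, so each computation makes finitely many random choices.\<close>

datatype 'a comp = Decide 'a | Choose nat "nat \<Rightarrow> 'a comp"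

text \<open>The entry \<open>r s m\<close> is the result of the \<open>s\<close>-th random choice of the computation, to be used in
  case this choice is among \<open>m + 1\<close> possibilities.\<close>

primrec decision :: "'a comp \<Rightarrow> (nat \<Rightarrow> nat \<Rightarrow> nat) \<Rightarrow> 'a" where
  "decision (Decide x) r = x"
| "decision (Choose m f) r = decision (f (r 0 m)) (\<lambda>s. r (Suc s))"

primrec bits :: "'a comp \<Rightarrow> (nat \<Rightarrow> nat \<Rightarrow> nat) \<Rightarrow> real" where
  "bits (Decide x) r = 0"
| "bits (Choose m f) r = log 2 (real m + 1) + bits (f (r 0 m)) (\<lambda>s. r (Suc s))"

text \<open>The randomness of an execution: the entry \<open>(t, i, s, m)\<close> serves the \<open>s\<close>-th choice of robot \<open>i\<close>
  in round \<open>t\<close>. All entries are independent.\<close>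

type_synonym randomness = "nat \<times> nat \<times> nat \<times> nat \<Rightarrow> nat"

definition random_source :: "randomness measure" where
  "random_source = PiM UNIV (\<lambda>(t, i, s, m). measure_pmf (pmf_of_set {0..m}))"


text \<open>The arguments of an algorithm are the snapshot (with multiplicities) and the robot's own
  position, both in local coordinates; the result is a destination in local coordinates. An algorithm
  without multiplicity detection is one that depends only on the support of the snapshot.\<close>

type_synonym algorithm = "point multiset \<Rightarrow> point \<Rightarrow> point comp"

text \<open>A coordinate system is given by the similarity (possibly orientation reversing) that maps global
  to local coordinates. It may change from round to round: \<open>F h i\<close> is the coordinate system of robot
  \<open>i\<close> in the current round, where \<open>h\<close> is the list of the configurations so far, most recent first.\<close>

type_synonym frames = "config list \<Rightarrow> nat \<Rightarrow> point \<Rightarrow> point"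

definition similarity :: "(point \<Rightarrow> point) \<Rightarrow> bool" where
  "similarity \<phi> \<longleftrightarrow> (\<exists>c>0. \<forall>x y. dist (\<phi> x) (\<phi> y) = c * dist x y)"

definition coordinate_systems :: "nat \<Rightarrow> frames \<Rightarrow> bool" where
  "coordinate_systems n F \<longleftrightarrow>
     (\<forall>h. h \<noteq> [] \<longrightarrow>
        (\<forall>i<n. similarity (F h i)) \<and>
        (\<forall>i<n. \<forall>j<n. hd h i = hd h j \<longrightarrow> F h i = F h j))"

definition computation :: "nat \<Rightarrow> algorithm \<Rightarrow> frames \<Rightarrow> config list \<Rightarrow> nat \<Rightarrow> point comp" where
  "computation n A F h i =
     A (image_mset (\<lambda>j. F h i (hd h j)) (mset_set {..<n})) (F h i (hd h i))"

definition next_config ::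
  "nat \<Rightarrow> algorithm \<Rightarrow> frames \<Rightarrow> config list \<Rightarrow> (nat \<Rightarrow> nat \<Rightarrow> nat \<Rightarrow> nat) \<Rightarrow> config" where
  "next_config n A F h r =
     (\<lambda>i. if i < n then inv (F h i) (decision (computation n A F h i) (r i)) else hd h i)"

definition counted_bits ::
  "nat \<Rightarrow> algorithm \<Rightarrow> frames \<Rightarrow> config list \<Rightarrow> (nat \<Rightarrow> nat \<Rightarrow> nat \<Rightarrow> nat) \<Rightarrow> real" where
  "counted_bits n A F h r =
     (\<Sum>i | i < n \<and> \<not> alone n (hd h) i. bits (computation n A F h i) (r i))"

primrec history ::
  "nat \<Rightarrow> algorithm \<Rightarrow> frames \<Rightarrow> config \<Rightarrow> randomness \<Rightarrow> nat \<Rightarrow> config list" where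
  "history n A F C \<omega> 0 = [C]"
| "history n A F C \<omega> (Suc t) =
     next_config n A F (history n A F C \<omega> t) (\<lambda>i s m. \<omega> (t, i, s, m)) # history n A F C \<omega> t"

definition config_at ::
  "nat \<Rightarrow> algorithm \<Rightarrow> frames \<Rightarrow> config \<Rightarrow> randomness \<Rightarrow> nat \<Rightarrow> config" where
  "config_at n A F C \<omega> t = hd (history n A F C \<omega> t)"

text \<open>Deterministic scattering is impossible, so reaching a scattered configuration is required with
  probability one, for all initial configurations and all admissible coordinate systems.\<close>

definition scattering_algorithm :: "nat \<Rightarrow> algorithm \<Rightarrow> bool" where
  "scattering_algorithm n A \<longleftrightarrow>
     (\<forall>F C. coordinate_systems n F \<longrightarrow>
        (AE \<omega> in random_source. \<exists>t. scattered n (config_at n A F C \<omega> t)))"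

text \<open>Only the rounds before the first scattered configuration contribute.\<close>

definition bits_to_scatter ::
  "nat \<Rightarrow> algorithm \<Rightarrow> frames \<Rightarrow> config \<Rightarrow> randomness \<Rightarrow> ennreal" where
  "bits_to_scatter n A F C \<omega> =
     (\<Sum>t. if \<exists>t'\<le>t. scattered n (config_at n A F C \<omega> t') then 0
          else ennreal (counted_bits n A F (history n A F C \<omega> t) (\<lambda>i s m. \<omega> (t, i, s, m))))"

text \<open>From a scattered initial configuration no bits are needed; the number of bits needed to scatter
  \<open>n\<close> robots refers to the worst initial configuration.\<close>

definition expected_bits :: "nat \<Rightarrow> algorithm \<Rightarrow> frames \<Rightarrow> ennreal" where
  "expected_bits n A F = (SUP C. \<integral>\<^sup>+ \<omega>. bits_to_scatter n A F C \<omega> \<partial>random_source)"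

end

theory Submission imports Defs begin

text \<open>Assign to a configuration the potential \<open>\<Sum>\<^sub>i log\<^sub>2 N\<^sub>i\<close>, where \<open>N\<^sub>i\<close> is the number of robots at the
  position of robot \<open>i\<close>. It is \<open>n log\<^sub>2 n\<close> if all robots are at one point and \<open>0\<close> in a scattered
  configuration. The bound holds along almost every single execution: no round decreases the potential
  by more than the number of bits counted in it. Indeed, the \<open>g\<close> robots of one point all run the same
  decision tree; let \<open>p\<close> be the law of its result. A branch that uses \<open>b\<close> bits has probability
  \<open>2\<^sup>-\<^sup>b\<close>, so a robot deciding for \<open>x\<close> uses at least \<open>- log\<^sub>2 (p x)\<close> bits; and Gibbs' inequality
  compares the empirical distribution \<open>N\<^sub>x / g\<close> of the decisions with \<open>p\<close>.\<close>

section \<open>Decision trees and Gibbs' inequality\<close>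

primrec law :: "'a comp \<Rightarrow> 'a pmf" where
  "law (Decide x) = return_pmf x"
| "law (Choose m f) = bind_pmf (pmf_of_set {0..m}) (\<lambda>j. law (f j))"

lemma bits_nonneg: "bits c r \<ge> 0"
  by (induction c arbitrary: r) (auto intro!: add_nonneg_nonneg)

lemma pmf_law_decision_ge:
  assumes "\<And>s m. r s m \<le> m"
  shows "pmf (law c) (decision c r) \<ge> 2 powr - bits c r"
  using assms
proof (induction c arbitrary: r)
  case (Decide x)
  then show ?case by simp
next
  case (Choose m f)
  let ?x = "decision (f (r 0 m)) (\<lambda>s. r (Suc s))"
  let ?b = "bits (f (r 0 m)) (\<lambda>s. r (Suc s))"
  have "2 powr - bits (Choose m f) r = 2 powr - ?b / (real m + 1)"
    by (simp add: powr_diff powr_minus divide_simps)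
  also have "\<dots> \<le> pmf (law (f (r 0 m))) ?x / (real m + 1)"
    using Choose by (intro divide_right_mono) auto
  \<comment> \<open>The bound on \<open>r\<close> puts the index \<open>r 0 m\<close> in the range
    of the sum. The other summands are nonnegative: they account for branches that reach the same
    result through another first choice.\<close>
  also have "\<dots> \<le> (\<Sum>j\<in>{0..m}. pmf (law (f j)) ?x) / (real m + 1)"
    using Choose.prems by (intro divide_right_mono member_le_sum) auto
  also have "\<dots> = pmf (law (Choose m f)) (decision (Choose m f) r)"
    by (simp add: pmf_bind_pmf_of_set add.commute)
  finally show ?case .
qed

text \<open>Sum \<open>ln z \<le> z - 1\<close> over \<open>G\<close> with
  \<open>z = card G * pmf p (x i) / N (x i)\<close>, where \<open>N y\<close> counts the indices
  with value \<open>y\<close>. The right-hand sides add up to at most 0, because the quotients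
  \<open>pmf p (x i) / N (x i)\<close> sum to the probability of the set of values taken.\<close>

lemma gibbs_empirical:
  fixes x :: "'i \<Rightarrow> 'a" and p :: "'a pmf"
  assumes G: "finite G" and pos: "\<And>i. i \<in> G \<Longrightarrow> pmf p (x i) > 0"
  shows "(\<Sum>i\<in>G. log 2 (card G * pmf p (x i))) \<le> (\<Sum>i\<in>G. log 2 (card {j\<in>G. x j = x i}))"
proof -
  define N where "N y = real (card {j\<in>G. x j = y})" for y
  have N: "N (x i) > 0" if "i \<in> G" for i
    using that G unfolding N_def by (auto simp: card_gt_0_iff)
  \<comment> \<open>Grouped by value, \<open>y\<close> occurs \<open>N y\<close> times, which
    cancels the denominator.\<close>
  have "(\<Sum>i\<in>G. pmf p (x i) / N (x i)) = (\<Sum>y\<in>x ` G. \<Sum>i | i \<in> G \<and> x i = y. pmf p (x i) / N (x i))"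
    by (rule sum.image_gen[OF G])
  also have "\<dots> = (\<Sum>y\<in>x ` G. N y * (pmf p y / N y))"
    by (intro sum.cong refl) (simp add: N_def)
  also have "\<dots> = (\<Sum>y\<in>x ` G. pmf p y)"
    using N by (intro sum.cong) force+
  also have "\<dots> = measure_pmf.prob p (x ` G)"
    using G by (simp add: measure_measure_pmf_finite)
  also have "\<dots> \<le> 1" by simp
  finally have le1: "(\<Sum>i\<in>G. pmf p (x i) / N (x i)) \<le> 1" .
  have "ln (card G * pmf p (x i)) - ln (N (x i)) \<le> card G * (pmf p (x i) / N (x i)) - 1"
    if i: "i \<in> G" for i
  proof -
    have "card G * pmf p (x i) > 0"
      using i G pos[OF i] by (intro mult_pos_pos) (auto simp: card_gt_0_iff)
    then show ?thesis
      using ln_le_minus_one[of "card G * pmf p (x i) / N (x i)"] N[OF i] by (simp add: ln_divide_pos)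
  qed
  then have "(\<Sum>i\<in>G. ln (card G * pmf p (x i)) - ln (N (x i)))
      \<le> (\<Sum>i\<in>G. card G * (pmf p (x i) / N (x i)) - 1)"
    by (rule sum_mono)
  also have "\<dots> = card G * (\<Sum>i\<in>G. pmf p (x i) / N (x i)) - card G"
    by (simp add: sum_subtractf sum_distrib_left)
  also have "\<dots> \<le> 0"
    using mult_left_mono[OF le1, of "card G"] by simp
  finally have "(\<Sum>i\<in>G. ln (card G * pmf p (x i))) \<le> (\<Sum>i\<in>G. ln (N (x i)))"
    by (simp add: sum_subtractf)
  then show ?thesis
    unfolding log_def N_def by (simp flip: sum_divide_distrib add: divide_right_mono)
qed

text \<open>The potential step for the robots \<open>G\<close> of a single point, with other robots
  ignored: Gibbs' inequality for \<open>law c\<close>, whose logarithm at \<open>x i\<close> is at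
  least \<open>- bits c (r i)\<close>.\<close>

lemma common_computation_bits:
  assumes G: "finite G" and r: "\<And>i s m. i \<in> G \<Longrightarrow> r i s m \<le> m"
    and x: "\<And>i. i \<in> G \<Longrightarrow> x i = decision c (r i)"
  shows "card G * log 2 (card G)
      \<le> (\<Sum>i\<in>G. bits c (r i)) + (\<Sum>i\<in>G. log 2 (card {j\<in>G. x j = x i}))"
proof -
  have ge: "pmf (law c) (x i) \<ge> 2 powr - bits c (r i)" if "i \<in> G" for i
    using pmf_law_decision_ge[of "r i" c] r[OF that] x[OF that] by simp
  have pos: "pmf (law c) (x i) > 0" if "i \<in> G" for i
    by (rule less_le_trans[OF _ ge[OF that]]) simp
  have "log 2 (card G) - bits c (r i) \<le> log 2 (card G * pmf (law c) (x i))" if i: "i \<in> G" for i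
  proof -
    have "card G > 0" using i G by (auto simp: card_gt_0_iff)
    moreover have "- bits c (r i) \<le> log 2 (pmf (law c) (x i))"
      using ge[OF i] pos[OF i] by (simp add: le_log_iff)
    ultimately show ?thesis using pos[OF i] by (simp add: log_mult)
  qed
  then have "(\<Sum>i\<in>G. log 2 (card G) - bits c (r i)) \<le> (\<Sum>i\<in>G. log 2 (card G * pmf (law c) (x i)))"
    by (rule sum_mono)
  also have "\<dots> \<le> (\<Sum>i\<in>G. log 2 (card {j\<in>G. x j = x i}))"
    by (rule gibbs_empirical[OF G pos])
  finally show ?thesis by (simp add: sum_subtractf)
qed

section \<open>The potential and its change in one round\<close>

definition potential :: "nat \<Rightarrow> config \<Rightarrow> real" where
  "potential n C = (\<Sum>i<n. log 2 (card {j. j < n \<and> C j = C i}))"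

lemma potential_const: "potential n (\<lambda>_. a) = real n * log 2 (real n)"
  by (simp add: potential_def)

lemma potential_scattered:
  assumes "scattered n C"
  shows "potential n C = 0"
  unfolding potential_def
proof (intro sum.neutral ballI)
  fix i assume "i \<in> {..<n}"
  then have "{j. j < n \<and> C j = C i} = {i}"
    using assms by (auto simp: scattered_def inj_on_def)
  then show "log 2 (card {j. j < n \<and> C j = C i}) = 0" by simp
qed

text \<open>Cardinality 0 is covered by the convention \<open>ln 0 = 0\<close>.\<close>

lemma log_card_nonneg: "log 2 (real (card S)) \<ge> 0"
  by (cases "card S = 0") (auto simp: log_def)

text \<open>Robots at one point share their frame and snapshot, hence their decision tree. So the
  inequality can be proved for each point separately and then summed over the occupied
  points.\<close>

lemma potential_step:
  assumes F: "coordinate_systems n F" and h: "h \<noteq> []" and r: "\<And>i s m. r i s m \<le> m"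
  shows "potential n (hd h) \<le> counted_bits n A F h r + potential n (next_config n A F h r)"
proof -
  define C where "C = hd h"
  define C' where "C' = next_config n A F h r"
  define b where "b i = (if alone n C i then 0 else bits (computation n A F h i) (r i))" for i
  define N where "N i = log 2 (card {j. j < n \<and> C j = C i})" for i
  define N' where "N' i = log 2 (card {j. j < n \<and> C' j = C' i})" for i
  have counted: "counted_bits n A F h r = (\<Sum>i<n. b i)"
    unfolding counted_bits_def b_def C_def by (intro sum.mono_neutral_cong_left) auto
  have group: "(\<Sum>i | i \<in> {..<n} \<and> C i = C k. N i) \<le> (\<Sum>i | i \<in> {..<n} \<and> C i = C k. b i + N' i)"
    if k: "k < n" for k
  proof -
    define G where "G = {i. i \<in> {..<n} \<and> C i = C k}"
    define c where "c = computation n A F h k"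
    define x where "x i = decision c (r i)" for i
    have fin: "finite G" by (simp add: G_def)
    have frame: "F h i = F h k" if "i \<in> G" for i
    proof -
      have "i < n" "hd h i = hd h k" using that by (auto simp: G_def C_def)
      with F h k show ?thesis unfolding coordinate_systems_def by blast
    qed
    then have comp: "computation n A F h i = c" if "i \<in> G" for i
      using that by (simp add: computation_def c_def G_def C_def)
    have C': "C' i = inv (F h k) (x i)" if "i \<in> G" for i
      using frame[OF that] comp[OF that] that
      by (simp add: next_config_def C'_def x_def G_def)
    have N: "N i = log 2 (card G)" if "i \<in> G" for i
      using that by (auto simp: N_def G_def)
    \<comment> \<open>Equal local decisions within \<open>G\<close> give equal destinations. Robots
      coming from other points may join them, which only raises the new potential.\<close>
    have N': "log 2 (card {j\<in>G. x j = x i}) \<le> N' i" if i: "i \<in> G" for i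
    proof -
      have "card {j\<in>G. x j = x i} \<le> card {j. j < n \<and> C' j = C' i}"
        using C' i by (intro card_mono) (auto simp: G_def)
      moreover have "card {j\<in>G. x j = x i} > 0"
        using i fin by (auto simp: card_gt_0_iff)
      ultimately show ?thesis by (simp add: N'_def)
    qed
    have "(\<Sum>i\<in>G. N i) \<le> (\<Sum>i\<in>G. b i + N' i)"
    \<comment> \<open>The bits of a lone robot are not counted, but its old potential is
      \<open>log 2 1 = 0\<close>. In a larger group nobody is alone, so all bits count.\<close>
    proof (cases "G = {k}")
      case True
      then have "(\<Sum>i\<in>G. N i) = 0" using N by simp
      also have "\<dots> \<le> (\<Sum>i\<in>G. b i + N' i)"
        unfolding b_def N'_def
        by (intro sum_nonneg add_nonneg_nonneg) (auto simp: bits_nonneg log_card_nonneg)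
      finally show ?thesis .
    next
      case False
      have "\<not> alone n C i" if i: "i \<in> G" for i
      proof
        assume "alone n C i"
        then have "G = {i}" "k = i"
          using i k by (auto simp: alone_def G_def)
        then show False using False by simp
      qed
      then have b: "b i = bits c (r i)" if "i \<in> G" for i
        using that comp by (simp add: b_def)
      have "(\<Sum>i\<in>G. N i) = card G * log 2 (card G)" using N by simp
      also have "\<dots> \<le> (\<Sum>i\<in>G. bits c (r i)) + (\<Sum>i\<in>G. log 2 (card {j\<in>G. x j = x i}))"
        by (rule common_computation_bits[OF fin r]) (simp add: x_def)
      also have "\<dots> \<le> (\<Sum>i\<in>G. b i + N' i)"
        using sum_mono[of G, OF N'] b by (simp add: sum.distrib)
      finally show ?thesis .
    qed
    then show ?thesis by (simp add: G_def)
  qed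
  have "potential n C = (\<Sum>i<n. N i)"
    by (simp add: potential_def N_def)
  also have "\<dots> = (\<Sum>y\<in>C ` {..<n}. \<Sum>i | i \<in> {..<n} \<and> C i = y. N i)"
    by (rule sum.image_gen) simp
  also have "\<dots> \<le> (\<Sum>y\<in>C ` {..<n}. \<Sum>i | i \<in> {..<n} \<and> C i = y. b i + N' i)"
    by (rule sum_mono) (use group in auto)
  also have "\<dots> = (\<Sum>i<n. b i + N' i)"
    by (rule sum.image_gen[symmetric]) simp
  also have "\<dots> = counted_bits n A F h r + potential n C'"
    by (simp add: counted sum.distrib potential_def N'_def)
  finally show ?thesis by (simp add: C_def C'_def)
qed

section \<open>Summation over an execution\<close>

lemma counted_bits_nonneg: "counted_bits n A F h r \<ge> 0"
  unfolding counted_bits_def by (intro sum_nonneg) (simp add: bits_nonneg)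

lemma history_nonempty: "history n A F C \<omega> t \<noteq> []"
  by (cases t) auto

lemma potential_le_counted_bits:
  assumes F: "coordinate_systems n F" and \<omega>: "\<And>t i s m. \<omega> (t, i, s, m) \<le> m"
  shows "potential n C
    \<le> (\<Sum>u<t. counted_bits n A F (history n A F C \<omega> u) (\<lambda>i s m. \<omega> (u, i, s, m)))
      + potential n (config_at n A F C \<omega> t)"
proof (induction t)
  case 0
  then show ?case by (simp add: config_at_def)
next
  case (Suc t)
  have "potential n (config_at n A F C \<omega> t)
    \<le> counted_bits n A F (history n A F C \<omega> t) (\<lambda>i s m. \<omega> (t, i, s, m))
      + potential n (config_at n A F C \<omega> (Suc t))"
    using potential_step[OF F history_nonempty[of n A F C \<omega> t], of "\<lambda>i s m. \<omega> (t, i, s, m)" A] \<omega>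
    by (simp add: config_at_def)
  with Suc show ?case by simp
qed

lemma bits_to_scatter_ge_potential:
  assumes F: "coordinate_systems n F" and \<omega>: "\<And>t i s m. \<omega> (t, i, s, m) \<le> m"
    and "\<exists>t. scattered n (config_at n A F C \<omega> t)"
  shows "ennreal (potential n C) \<le> bits_to_scatter n A F C \<omega>"
proof -
  \<comment> \<open>By minimality of \<open>T\<close>, the rounds \<open>t < T\<close> are exactly
    those whose bits enter \<open>bits_to_scatter\<close>; round \<open>T\<close> already starts
    scattered.\<close>
  define T where "T = (LEAST t. scattered n (config_at n A F C \<omega> t))"
  define b where "b u = counted_bits n A F (history n A F C \<omega> u) (\<lambda>i s m. \<omega> (u, i, s, m))" for u
  define f where "f t = (if \<exists>t'\<le>t. scattered n (config_at n A F C \<omega> t') then 0 else ennreal (b t))"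
    for t
  have T: "scattered n (config_at n A F C \<omega> T)"
    using assms(3) unfolding T_def by (rule LeastI_ex)
  have before: "f t = ennreal (b t)" if "t < T" for t
    using that by (auto simp: f_def T_def dest: not_less_Least order_le_less_trans)
  have "potential n C \<le> (\<Sum>t<T. b t)"
    using potential_le_counted_bits[OF F \<omega>, where A = A and C = C and t = T] potential_scattered[OF T]
    by (simp add: b_def)
  then have "ennreal (potential n C) \<le> ennreal (\<Sum>t<T. b t)"
    by (rule ennreal_leI)
  also have "\<dots> = (\<Sum>t<T. ennreal (b t))"
    by (simp add: b_def counted_bits_nonneg)
  also have "\<dots> = (\<Sum>t<T. f t)"
    using before by simp
  also have "\<dots> \<le> (\<Sum>t. f t)"
    by (rule sum_le_suminf) (auto intro: summableI)
  finally show ?thesis unfolding bits_to_scatter_def f_def b_def .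
qed

section \<open>Almost sure bounds and the expectation\<close>

lemma prob_space_random_source: "prob_space random_source"
  unfolding random_source_def
  by (intro prob_space_PiM) (auto simp: measure_pmf.prob_space_axioms split: prod.splits)

text \<open>Each entry is uniform on \<open>{0..m}\<close>, and the index set is countable. This
  transfers the bounds for single executions to almost all of them.\<close>

lemma AE_random_source_bounded: "AE \<omega> in random_source. \<forall>t i s m. \<omega> (t, i, s, m) \<le> m"
proof -
  let ?M = "\<lambda>(t, i, s, m). measure_pmf (pmf_of_set {0..m})"
  have "AE \<omega> in random_source. \<omega> (t, i, s, m) \<le> m" for t i s m :: nat
    unfolding random_source_def
  proof (rule AE_PiM_component[where M = ?M and i = "(t, i, s, m)" and P = "\<lambda>k. k \<le> m"])
    show "prob_space (?M k)" for k :: "nat \<times> nat \<times> nat \<times> nat"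
      by (auto simp: measure_pmf.prob_space_axioms split: prod.splits)
    show "AE k in ?M (t, i, s, m). k \<le> m"
      unfolding prod.case by (simp add: AE_measure_pmf_iff)
  qed simp
  then show ?thesis by (simp add: AE_all_countable)
qed

theorem theorem2:
  fixes n :: nat and A :: algorithm and F :: frames
  assumes "scattering_algorithm n A"
    and "coordinate_systems n F"
  shows "expected_bits n A F \<ge> ennreal (real n * log 2 (real n))"
proof -
  interpret prob_space random_source by (rule prob_space_random_source)
  \<comment> \<open>With all robots gathered at one point, the potential is
    \<open>n log_2 n\<close>.\<close>
  let ?C = "(\<lambda>_. 0) :: config"
  have "AE \<omega> in random_source. \<exists>t. scattered n (config_at n A F ?C \<omega> t)"
    using assms unfolding scattering_algorithm_def by blast
  with AE_random_source_bounded
  have "AE \<omega> in random_source. ennreal (potential n ?C) \<le> bits_to_scatter n A F ?C \<omega>"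
    by eventually_elim (rule bits_to_scatter_ge_potential[OF assms(2)], auto)
  then have "(\<integral>\<^sup>+ \<omega>. ennreal (potential n ?C) \<partial>random_source)
      \<le> (\<integral>\<^sup>+ \<omega>. bits_to_scatter n A F ?C \<omega> \<partial>random_source)"
    by (rule nn_integral_mono_AE)
  also have "\<dots> \<le> expected_bits n A F"
    unfolding expected_bits_def by (rule SUP_upper) simp
  finally show ?thesis
    by (simp add: potential_const emeasure_space_1)
qed

end
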